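(* Let $\mathfrak{T}$ be a nonempty closed subset of $\mathrm{AO}(N)$ such that $A_K^{t,\Phi}$ is $\mathfrak{T}$-admissible (i.e. multiplicative on $\mathfrak{T}$). Then for each left ideal $L$ of $A$ there exists a $\mathfrak{T}$-universal Gröbner basis of $L$. In particular: if $A_K^{t,\Phi}$ is admissible (i.e. multiplicative on $\mathrm{AO}(N)$), then every left ideal of $A$ has an $\mathrm{AO}(N)$-universal Gröbner basis; and if $A_K^{t,\Phi}$ is degree-compatible (i.e. multiplicative on $\mathrm{DCO}(N)$), then every left ideal of $A$ has a $\mathrm{DCO}(N)$-universal Gröbner basis.
   Context: An algebra of countable type $A_K^{t,\Phi}=(A,K,t,\Phi)$ consists of an associative unital, not necessarily commutative algebra $A$ over a field $K$, a nonnegative integer $t$, and a $K$-module isomorphism $\Phi:A\to K[X]=K[X_1,\dots,X_t]$ (commutative polynomial ring; $\Phi$ need not be multiplicative). $M=\{X^\nu\mid\nu\in\mathbb{N}_0^t\}$ is the set of monomials and $N=\Phi^{-1}(M)$ is the canonical $K$-basis of $A$. For a set $S$, $\mathrm{TO}(S)$ is the set of all total orderings on $S$ (antisymmetric, transitive, total binary relations), with the coarsest topology for which all sets $\mathfrak{U}_{(a,b)}=\{{\preceq}\in\mathrm{TO}(S)\mid a\preceq b\}$ are open; subsets carry the relative topology. Let $\phi:\mathrm{TO}(N)\to\mathrm{TO}(M)$ be the bijection given by $\Phi(n)\,\phi({\preceq})\,\Phi(n')\Leftrightarrow n\preceq n'$. For ${\preceq}\in\mathrm{TO}(N)$ and $a\in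 A\setminus\{0\}$, $\mathrm{LM}_\preceq(a)\in M$ is the $\phi({\preceq})$-maximal monomial occurring in $\Phi(a)$ with nonzero coefficient. For $H\subseteq A$, $\mathrm{LM}_\preceq(H)$ is the ideal of $K[X]$ generated by $\{\mathrm{LM}_\preceq(h)\mid h\in H\setminus\{0\}\}$. For $\mathfrak{T}\subseteq\mathrm{TO}(N)$, $A_K^{t,\Phi}$ is multiplicative on $\mathfrak{T}$ if $A$ is a domain and $\mathrm{LM}_\preceq(ab)=\mathrm{LM}_\preceq(a)\mathrm{LM}_\preceq(b)$ for all $a,b\in A\setminus\{0\}$ and all ${\preceq}\in\mathfrak{T}$. $\mathrm{CO}(M)$ is the set of compatible orderings: those ${\leq}\in\mathrm{TO}(M)$ with $X^\upsilon\leq X^\nu\Rightarrow X^{\upsilon+\gamma}\leq X^{\nu+\gamma}$ for all $\upsilon,\nu,\gamma\in\mathbb{N}_0^t$. $\mathrm{AO}(M)$ is the set of ${\leq}\in\mathrm{CO}(M)$ with $1\leq m$ for all $m\in M$. $\mathrm{DCO}(M)$ is the set of ${\leq}\in\mathrm{CO}(M)$ such that for every nonzero $p\in K[X]$ the $\leq$-maximal monomial of $p$ has degree $\deg(p)$ (total degree). $\mathrm{AO}(N)=\phi^{-1}(\mathrm{AO}(M))$, $\mathrm{DCO}(N)=\phi^{-1}(\mathrm{DCO}(M))$. A Gröbner basis of a left ideal $L$ of $A$ with respect to ${\preceq}\in\mathrm{TO}(N)$ is a finite subset $G\subseteq L$ with $L=\sum_{g\in G}Ag$ and $\mathrm{LM}_\preceq(L)=\mathrm{LM}_\preceq(G)$.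 A $\mathfrak{T}$-universal Gröbner basis of $L$ is a finite subset of $L$ that is a Gröbner basis of $L$ with respect to every ${\preceq}\in\mathfrak{T}$. *)

theory Defs
  imports "HOL-Analysis.Abstract_Topology" "HOL-Library.Poly_Mapping"
begin

text \<open>
  An exponent is a finitely supported function \<open>nat \<Rightarrow>\<^sub>0 nat\<close>, and a polynomial is a finitely
  supported function on exponents. The type \<open>'k mpoly\<close> therefore has countably many variables;
  \<open>K[X\<^sub>1,\<dots>,X\<^sub>t]\<close> is its subring \<open>polys t\<close> of polynomials in the variables with
  index \<open>< t\<close>. This covers every \<open>t\<close>, including \<open>t = 0\<close>.
\<close>

type_synonym 'k mpoly = "(nat \<Rightarrow>\<^sub>0 nat) \<Rightarrow>\<^sub>0 'k"

definition exponents :: "nat \<Rightarrow> (nat \<Rightarrow>\<^sub>0 nat) set" where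
  "exponents t = {\<nu>. Poly_Mapping.keys \<nu> \<subseteq> {..<t}}"

definition polys :: "nat \<Rightarrow> 'k::field mpoly set" where
  "polys t = {p. Poly_Mapping.keys p \<subseteq> exponents t}"

definition monom :: "(nat \<Rightarrow>\<^sub>0 nat) \<Rightarrow> 'k::field mpoly" where
  "monom \<nu> = Poly_Mapping.single \<nu> 1"

definition monomials :: "nat \<Rightarrow> 'k::field mpoly set" where
  "monomials t = monom ` exponents t"

definition monomials_of :: "'k::field mpoly \<Rightarrow> 'k mpoly set" where
  "monomials_of p = monom ` Poly_Mapping.keys p"

definition poly_scale :: "'k::field \<Rightarrow> 'k mpoly \<Rightarrow> 'k mpoly" where
  "poly_scale c p = Poly_Mapping.single 0 c * p"

definition exponent_degree :: "(nat \<Rightarrow>\<^sub>0 nat) \<Rightarrow> nat" where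
  "exponent_degree \<nu> = (\<Sum>i\<in>Poly_Mapping.keys \<nu>. Poly_Mapping.lookup \<nu> i)"

text \<open>The total degree; its value at \<open>p = 0\<close> is unspecified and never used.\<close>

definition total_degree :: "'k::field mpoly \<Rightarrow> nat" where
  "total_degree p = Max (exponent_degree ` Poly_Mapping.keys p)"

definition poly_ideal :: "nat \<Rightarrow> 'k::field mpoly set \<Rightarrow> bool" where
  "poly_ideal t I \<longleftrightarrow>
     I \<subseteq> polys t \<and> 0 \<in> I \<and> (\<forall>p\<in>I. \<forall>q\<in>I. p + q \<in> I) \<and> (\<forall>p\<in>polys t. \<forall>q\<in>I. p * q \<in> I)"

text \<open>
  A total ordering on \<open>S\<close> is a relation \<open>r \<subseteq> S \<times> S\<close>, where \<open>(a, b) \<in> r\<close> means \<open>a \<preceq> b\<close>.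
  Adding \<open>TO S\<close> to the subbasis matters only for \<open>S = {}\<close>, where no set \<open>\<UU>\<^bsub>(a,b)\<^esub>\<close> exists.
\<close>

definition TO :: "'s set \<Rightarrow> 's rel set" where
  "TO S = {r. linear_order_on S r}"

definition TO_topology :: "'s set \<Rightarrow> 's rel topology" where
  "TO_topology S =
     topology_generated_by (insert (TO S) {{r \<in> TO S. (a, b) \<in> r} | a b. a \<in> S \<and> b \<in> S})"

definition CO_M :: "nat \<Rightarrow> 'k::field mpoly rel set" where
  "CO_M t = {r \<in> TO (monomials t).
     \<forall>\<upsilon>\<in>exponents t. \<forall>\<nu>\<in>exponents t. \<forall>\<gamma>\<in>exponents t.
       (monom \<upsilon>, monom \<nu>) \<in> r \<longrightarrow> (monom (\<upsilon> + \<gamma>), monom (\<nu> + \<gamma>)) \<in> r}"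

definition AO_M :: "nat \<Rightarrow> 'k::field mpoly rel set" where
  "AO_M t = {r \<in> CO_M t. \<forall>m\<in>monomials t. (1, m) \<in> r}"

definition max_monomial :: "'k::field mpoly rel \<Rightarrow> 'k mpoly \<Rightarrow> 'k mpoly" where
  "max_monomial r p = (THE m. m \<in> monomials_of p \<and> (\<forall>m'\<in>monomials_of p. (m', m) \<in> r))"

definition DCO_M :: "nat \<Rightarrow> 'k::field mpoly rel set" where
  "DCO_M t = {r \<in> CO_M t.
     \<forall>p\<in>polys t. p \<noteq> 0 \<longrightarrow> total_degree (max_monomial r p) = total_degree p}"

definition left_ideal :: "'a::ring_1 set \<Rightarrow> bool" where
  "left_ideal L \<longleftrightarrow> 0 \<in> L \<and> (\<forall>x\<in>L. \<forall>y\<in>L. x + y \<in> L) \<and> (\<forall>a. \<forall>x\<in>L. a * x \<in> L)"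

text \<open>
  The class \<open>ring_1\<close> requires \<open>0 \<noteq> 1\<close>, which excludes nothing: \<open>A\<close> is linearly isomorphic to
  the nonzero space \<open>polys t\<close>.
\<close>

locale countable_type_algebra = vector_space scale
  for scale :: "'k::field \<Rightarrow> 'a::ring_1 \<Rightarrow> 'a" +
  fixes t :: nat and \<Phi> :: "'a \<Rightarrow> 'k mpoly"
  assumes scale_mult_left: "scale c a * b = scale c (a * b)"
    and scale_mult_right: "a * scale c b = scale c (a * b)"
    and \<Phi>_bij: "bij_betw \<Phi> UNIV (polys t)"
    and \<Phi>_add: "\<Phi> (a + b) = \<Phi> a + \<Phi> b"
    and \<Phi>_scale: "\<Phi> (scale c a) = poly_scale c (\<Phi> a)"

definition canonical_basis :: "nat \<Rightarrow> ('a::ring_1 \<Rightarrow> 'k::field mpoly) \<Rightarrow> 'a set" where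
  "canonical_basis t \<Phi> = \<Phi> -` monomials t"

text \<open>The bijection \<open>\<phi>\<close> from \<open>TO (canonical_basis t \<Phi>)\<close> onto \<open>TO (monomials t)\<close>.\<close>

definition transport_order :: "('a \<Rightarrow> 'k::field mpoly) \<Rightarrow> 'a rel \<Rightarrow> 'k mpoly rel" where
  "transport_order \<Phi> r = {(\<Phi> n, \<Phi> n') | n n'. (n, n') \<in> r}"

definition AO_N :: "nat \<Rightarrow> ('a::ring_1 \<Rightarrow> 'k::field mpoly) \<Rightarrow> 'a rel set" where
  "AO_N t \<Phi> = {r \<in> TO (canonical_basis t \<Phi>). transport_order \<Phi> r \<in> AO_M t}"

definition DCO_N :: "nat \<Rightarrow> ('a::ring_1 \<Rightarrow> 'k::field mpoly) \<Rightarrow> 'a rel set" where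
  "DCO_N t \<Phi> = {r \<in> TO (canonical_basis t \<Phi>). transport_order \<Phi> r \<in> DCO_M t}"

definition LM :: "('a::ring_1 \<Rightarrow> 'k::field mpoly) \<Rightarrow> 'a rel \<Rightarrow> 'a \<Rightarrow> 'k mpoly" where
  "LM \<Phi> r a = max_monomial (transport_order \<Phi> r) (\<Phi> a)"

definition LM_ideal ::
    "nat \<Rightarrow> ('a::ring_1 \<Rightarrow> 'k::field mpoly) \<Rightarrow> 'a rel \<Rightarrow> 'a set \<Rightarrow> 'k mpoly set" where
  "LM_ideal t \<Phi> r H = poly_ideal t hull (LM \<Phi> r ` (H - {0}))"

definition multiplicative_on :: "('a::ring_1 \<Rightarrow> 'k::field mpoly) \<Rightarrow> 'a rel set \<Rightarrow> bool" where
  "multiplicative_on \<Phi> T \<longleftrightarrow>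
     (\<forall>a b :: 'a. a * b = 0 \<longrightarrow> a = 0 \<or> b = 0) \<and>
     (\<forall>r\<in>T. \<forall>a b. a \<noteq> 0 \<longrightarrow> b \<noteq> 0 \<longrightarrow> LM \<Phi> r (a * b) = LM \<Phi> r a * LM \<Phi> r b)"

definition groebner_basis ::
    "nat \<Rightarrow> ('a::ring_1 \<Rightarrow> 'k::field mpoly) \<Rightarrow> 'a rel \<Rightarrow> 'a set \<Rightarrow> 'a set \<Rightarrow> bool" where
  "groebner_basis t \<Phi> r L G \<longleftrightarrow>
     finite G \<and> G \<subseteq> L \<and> L = {\<Sum>g\<in>G. c g * g | c. True} \<and> LM_ideal t \<Phi> r L = LM_ideal t \<Phi> r G"

definition universal_groebner_basis ::
    "nat \<Rightarrow> ('a::ring_1 \<Rightarrow> 'k::field mpoly) \<Rightarrow> 'a rel set \<Rightarrow> 'a set \<Rightarrow> 'a set \<Rightarrow> bool" where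
  "universal_groebner_basis t \<Phi> T L G \<longleftrightarrow>
     finite G \<and> G \<subseteq> L \<and> (\<forall>r\<in>T. groebner_basis t \<Phi> r L G)"

end

theory Submission
  imports Defs "HOL-Analysis.Function_Topology"
begin

text \<open>
  The orderings in \<open>AO_N t \<Phi>\<close> are well-orderings by Dickson's lemma, so division with remainder
  terminates. If \<open>G\<close> is a Groebner basis of \<open>L\<close> with respect to \<open>r\<close> and the elements of \<open>G\<close> have the
  same leading monomials with respect to \<open>s\<close>, then \<open>G\<close> is also one with respect to \<open>s\<close>: otherwise
  \<open>s\<close>-division by \<open>G\<close> would leave a nonzero remainder in \<open>L\<close> none of whose monomials is a multiple of
  a leading monomial of \<open>G\<close>, although its \<open>r\<close>-leading monomial must be one. As \<open>G\<close> is finite, the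
  orderings with the same leading monomials on \<open>G\<close> contain a neighbourhood of \<open>r\<close>. The set \<open>T\<close> is
  compact, because \<open>AO_N t \<Phi>\<close> is the image of a closed subset of the compact product space of all
  relations. So finitely many of these neighbourhoods cover \<open>T\<close>, and the union of the corresponding
  Groebner bases is universal.
\<close>

subsection \<open>Dickson's lemma\<close>

text \<open>A monotone subsequence always exists. If it is decreasing, it attains its minimum and is
  constant from there on, so its tail is also increasing.\<close>

lemma nat_incseq_subseq:
  fixes s :: "nat \<Rightarrow> nat"
  shows "\<exists>f::nat\<Rightarrow>nat. strict_mono f \<and> incseq (s \<circ> f)"
proof -
  obtain f :: "nat \<Rightarrow> nat" where f: "strict_mono f" "monoseq (\<lambda>n. s (f n))"
    using seq_monosub by blast
  show ?thesis
  proof (cases "incseq (\<lambda>n. s (f n))")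
    case True
    then show ?thesis using f(1) by (auto simp: o_def)
  next
    case False
    then have dec: "decseq (\<lambda>n. s (f n))"
      using f(2) by (auto simp: monoseq_iff)
    obtain N where N: "\<And>n. s (f N) \<le> s (f n)"
      using ex_has_least_nat[of "\<lambda>_. True" _ "\<lambda>n. s (f n)"] by auto
    have "s (f (N + n)) = s (f N)" for n
      using N[of "N + n"] decseqD[OF dec, of N "N + n"] by simp
    then have "incseq (s \<circ> (\<lambda>n. f (N + n)))"
      by (simp add: incseq_def)
    moreover have "strict_mono (\<lambda>n. f (N + n))"
      using f(1) by (simp add: strict_mono_def)
    ultimately show ?thesis by blast
  qed
qed

text \<open>The subsequence is thinned out once for each component; components that are already
  monotone stay monotone under further thinning.\<close>

lemma incseq_subseq_componentwise:
  fixes s :: "nat \<Rightarrow> nat \<Rightarrow> nat"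
  shows "\<exists>f::nat\<Rightarrow>nat. strict_mono f \<and> (\<forall>i<t. incseq (\<lambda>n. s (f n) i))"
proof (induction t)
  case 0
  show ?case using strict_mono_id by blast
next
  case (Suc t)
  then obtain f where f: "strict_mono f" "\<And>i. i < t \<Longrightarrow> incseq (\<lambda>n. s (f n) i)" by blast
  obtain g where g: "strict_mono g" "incseq ((\<lambda>n. s (f n) t) \<circ> g)"
    using nat_incseq_subseq by blast
  have "incseq (\<lambda>n. s (f (g n)) i)" if "i < Suc t" for i
  proof (cases "i = t")
    case True
    then show ?thesis using g(2) by (simp add: o_def)
  next
    case False
    then show ?thesis
      using f(2)[of i] that g(1) by (simp add: incseq_def strict_mono_less_eq)
  qed
  then show ?case
    using strict_mono_o[OF f(1) g(1)] by (intro exI[of _ "f \<circ> g"]) (simp add: o_def)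
qed

lemma zero_in_exponents [simp]: "0 \<in> exponents t"
  by (simp add: exponents_def)

lemma exponents_add_iff [simp]: "\<mu> + \<nu> \<in> exponents t \<longleftrightarrow> \<mu> \<in> exponents t \<and> \<nu> \<in> exponents t"
  by (auto simp: exponents_def in_keys_iff lookup_add subset_iff)

text \<open>The quotient is the truncated difference \<open>\<nu> - \<mu>\<close>. Nothing is
  truncated: \<open>\<mu>\<close> vanishes at the indices from \<open>t\<close> on, so the
  inequality holds at every index.\<close>

lemma exponents_diff:
  assumes "\<mu> \<in> exponents t" "\<nu> \<in> exponents t"
    and le: "\<And>i. i < t \<Longrightarrow> Poly_Mapping.lookup \<mu> i \<le> Poly_Mapping.lookup \<nu> i"
  shows "\<exists>\<gamma>\<in>exponents t. \<nu> = \<mu> + \<gamma>"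
proof -
  have "Poly_Mapping.lookup \<mu> i = 0" if "\<not> i < t" for i
    using assms(1) that by (auto simp: exponents_def in_keys_iff subset_iff)
  then have "Poly_Mapping.lookup \<mu> i \<le> Poly_Mapping.lookup \<nu> i" for i
    using le[of i] by (cases "i < t") auto
  then have "\<nu> = \<mu> + (\<nu> - \<mu>)"
    by (intro poly_mapping_eqI) (simp add: lookup_add lookup_minus)
  with assms(2) show ?thesis
    by (metis exponents_add_iff)
qed

lemma dickson_sequence:
  fixes s :: "nat \<Rightarrow> (nat \<Rightarrow>\<^sub>0 nat)"
  assumes s: "\<And>n. s n \<in> exponents t"
  shows "\<exists>m n. m < n \<and> (\<exists>\<gamma>\<in>exponents t. s n = s m + \<gamma>)"
proof -
  obtain f where f: "strict_mono f"
      "\<And>i. i < t \<Longrightarrow> incseq (\<lambda>n. Poly_Mapping.lookup (s (f n)) i)"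
    using incseq_subseq_componentwise[of t "\<lambda>n. Poly_Mapping.lookup (s n)"] by blast
  have "\<exists>\<gamma>\<in>exponents t. s (f 1) = s (f 0) + \<gamma>"
    by (intro exponents_diff s) (use f(2) in \<open>auto simp: incseq_def\<close>)
  moreover have "f 0 < f 1"
    using f(1) by (simp add: strict_mono_def)
  ultimately show ?thesis by blast
qed

text \<open>If no finite subset sufficed, one could choose recursively a sequence in
  \<open>S\<close> none of whose terms is a multiple of an earlier one, against
  \<open>dickson_sequence\<close>.\<close>

lemma dickson:
  assumes S: "S \<subseteq> exponents t"
  shows "\<exists>F. finite F \<and> F \<subseteq> S \<and> (\<forall>\<nu>\<in>S. \<exists>\<mu>\<in>F. \<exists>\<gamma>\<in>exponents t. \<nu> = \<mu> + \<gamma>)"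
proof (rule ccontr)
  assume "\<not> ?thesis"
  then have no: "\<exists>\<nu>\<in>S. \<forall>\<mu>\<in>F. \<forall>\<gamma>\<in>exponents t. \<nu> \<noteq> \<mu> + \<gamma>"
    if "finite F" "F \<subseteq> S" for F
    using that by (simp only: not_ex de_Morgan_conj) metis
  \<comment> \<open>\<open>P f n \<nu>\<close> says that \<open>\<nu>\<close> is a legal choice for
    term \<open>n\<close>. It depends on \<open>f\<close> only below \<open>n\<close>, as the
    recursive choice principle requires.\<close>
  define P where
    "P f n \<nu> \<longleftrightarrow> \<nu> \<in> S \<and> (\<forall>m<n. \<forall>\<gamma>\<in>exponents t. \<nu> \<noteq> f m + \<gamma>)"
    for f :: "nat \<Rightarrow> (nat \<Rightarrow>\<^sub>0 nat)" and n \<nu>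
  have "\<exists>f. \<forall>n. P f n (f n)"
  proof (rule dependent_wellorder_choice)
    show "P f n \<nu> = P g n \<nu>" if "\<And>m. m < n \<Longrightarrow> f m = g m" for \<nu> f g n
      using that by (simp add: P_def)
    show "\<exists>\<nu>. P f n \<nu>" if "\<And>m. m < n \<Longrightarrow> P f m (f m)" for n f
    proof -
      have "finite (f ` {..<n})" "f ` {..<n} \<subseteq> S" using that by (auto simp: P_def)
      then obtain \<nu> where "\<nu> \<in> S" "\<forall>\<mu>\<in>f ` {..<n}. \<forall>\<gamma>\<in>exponents t. \<nu> \<noteq> \<mu> + \<gamma>"
        using no[of "f ` {..<n}"] by blast
      then show ?thesis
        unfolding P_def by (intro exI[of _ \<nu>]) simp
    qed
  qed
  then obtain f where f: "\<And>n. P f n (f n)" by blast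
  then have "\<And>n. f n \<in> exponents t" using S by (auto simp: P_def)
  from dickson_sequence[of f t, OF this] f show False
    by (auto simp: P_def)
qed

subsection \<open>Orderings of monomials\<close>

lemma linear_order_on_finite_max:
  assumes "linear_order_on A r" "finite B" "B \<noteq> {}" "B \<subseteq> A"
  shows "\<exists>m\<in>B. \<forall>x\<in>B. (x, m) \<in> r"
  using assms(2,3,4)
proof (induction B rule: finite_ne_induct)
  case (singleton x)
  then show ?case
    using assms(1) by (simp add: order_on_defs refl_on_def)
next
  case (insert x B)
  then obtain m where m: "m \<in> B" "\<forall>y\<in>B. (y, m) \<in> r" by auto
  have r: "refl_on A r" "trans r" "total_on A r"
    using assms(1) by (simp_all add: order_on_defs)
  from insert m have "x \<in> A" "m \<in> A" by auto
  then consider "(x, m) \<in> r" | "(m, x) \<in> r"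
    using r unfolding refl_on_def total_on_def by metis
  then show ?case
  proof cases
    case 1
    then show ?thesis using m by auto
  next
    case 2
    then have "\<forall>y\<in>insert x B. (y, x) \<in> r"
      using m r \<open>x \<in> A\<close> by (metis insert_iff refl_on_def transD)
    then show ?thesis by blast
  qed
qed

lemma monom_eq_iff [simp]: "(monom \<mu> :: 'k::field mpoly) = monom \<nu> \<longleftrightarrow> \<mu> = \<nu>"
proof
  assume "(monom \<mu> :: 'k mpoly) = monom \<nu>"
  then have "Poly_Mapping.keys (monom \<mu> :: 'k mpoly) = Poly_Mapping.keys (monom \<nu> :: 'k mpoly)"
    by simp
  then show "\<mu> = \<nu>" by (simp add: monom_def)
qed simp

lemma keys_monom [simp]: "Poly_Mapping.keys (monom \<nu> :: 'k::field mpoly) = {\<nu>}"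
  by (simp add: monom_def)

lemma monom_add: "monom (\<mu> + \<nu>) = (monom \<mu> * monom \<nu> :: 'k::field mpoly)"
  by (simp add: monom_def mult_single)

lemma monom_zero: "monom 0 = (1 :: 'k::field mpoly)"
  by (simp add: monom_def)

lemma monom_in_polys [simp]: "(monom \<nu> :: 'k::field mpoly) \<in> polys t \<longleftrightarrow> \<nu> \<in> exponents t"
  by (simp add: polys_def)

lemma monom_in_monomials [simp]:
  "(monom \<nu> :: 'k::field mpoly) \<in> monomials t \<longleftrightarrow> \<nu> \<in> exponents t"
  by (auto simp: monomials_def)

lemma lookup_poly_scale [simp]:
  "Poly_Mapping.lookup (poly_scale c p) \<nu> = c * Poly_Mapping.lookup p \<nu>"
  by (simp add: poly_scale_def flip: mult_map_scale_conv_mult) (simp add: map.rep_eq when_def)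

lemma max_monomial_eqI:
  assumes "antisym r" "\<nu> \<in> Poly_Mapping.keys p"
    and "\<And>\<mu>. \<mu> \<in> Poly_Mapping.keys p \<Longrightarrow> (monom \<mu>, monom \<nu>) \<in> r"
  shows "max_monomial r p = monom \<nu>"
  unfolding max_monomial_def monomials_of_def
  using assms by (intro the_equality) (auto dest: antisymD)

text \<open>The support is finite and nonempty, so a linear order has a maximum on it. This settles
  the definite description in \<open>max_monomial\<close>.\<close>

lemma max_monomialE:
  assumes r: "r \<in> TO (monomials t)" and p: "p \<in> polys t" "p \<noteq> 0"
  obtains \<nu> where "\<nu> \<in> Poly_Mapping.keys p" "max_monomial r p = monom \<nu>"
    "\<And>\<mu>. \<mu> \<in> Poly_Mapping.keys p \<Longrightarrow> (monom \<mu>, monom \<nu>) \<in> r"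
proof -
  have lin: "linear_order_on (monomials t) r" using r by (simp add: TO_def)
  have "\<exists>m\<in>monom ` Poly_Mapping.keys p. \<forall>x\<in>monom ` Poly_Mapping.keys p. (x, m) \<in> r"
    by (rule linear_order_on_finite_max[OF lin]) (use p in \<open>auto simp: polys_def\<close>)
  then obtain \<nu> where \<nu>: "\<nu> \<in> Poly_Mapping.keys p"
    "\<And>\<mu>. \<mu> \<in> Poly_Mapping.keys p \<Longrightarrow> (monom \<mu>, monom \<nu>) \<in> r" by blast
  moreover have "max_monomial r p = monom \<nu>"
    using lin \<nu> by (intro max_monomial_eqI) (auto simp: order_on_defs)
  ultimately show ?thesis using that by blast
qed


section \<open>The canonical basis, indexed by exponents\<close>

context countable_type_algebra
begin

text \<open>Indexing the canonical basis by exponents allows conditions on orderings to be stated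
  without \<open>transport_order\<close>. Only the values on \<open>exponents t\<close> are
  meaningful.\<close>

definition basis :: "(nat \<Rightarrow>\<^sub>0 nat) \<Rightarrow> 'a" where
  "basis \<nu> = inv \<Phi> (monom \<nu>)"

lemma inj_\<Phi>: "inj \<Phi>"
  using \<Phi>_bij by (simp add: bij_betw_def)

lemma \<Phi>_in_polys [simp]: "\<Phi> a \<in> polys t"
  using \<Phi>_bij by (auto simp: bij_betw_def)

lemma keys_\<Phi>_exponents: "\<nu> \<in> Poly_Mapping.keys (\<Phi> a) \<Longrightarrow> \<nu> \<in> exponents t"
  using \<Phi>_in_polys[of a] unfolding polys_def by blast

lemma \<Phi>_basis [simp]: "\<nu> \<in> exponents t \<Longrightarrow> \<Phi> (basis \<nu>) = monom \<nu>"
  unfolding basis_def using \<Phi>_bij by (intro f_inv_into_f) (simp add: bij_betw_def)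

lemma \<Phi>_eq_monom_iff [simp]: "\<nu> \<in> exponents t \<Longrightarrow> \<Phi> a = monom \<nu> \<longleftrightarrow> a = basis \<nu>"
  using inj_\<Phi> by (metis \<Phi>_basis injD)

lemma \<Phi>_zero [simp]: "\<Phi> 0 = 0"
  using \<Phi>_add[of 0 0] by (simp only: add_0 add_cancel_right_right)

lemma \<Phi>_diff: "\<Phi> (a - b) = \<Phi> a - \<Phi> b"
  using \<Phi>_add[of "a - b" b] by (simp add: eq_diff_eq)

lemma \<Phi>_eq_zero_iff [simp]: "\<Phi> a = 0 \<longleftrightarrow> a = 0"
  using inj_\<Phi> by (metis \<Phi>_zero injD)

lemma basis_nonzero [simp]: "\<nu> \<in> exponents t \<Longrightarrow> basis \<nu> \<noteq> 0"
  by (metis \<Phi>_basis \<Phi>_zero keys_monom keys_zero insert_not_empty)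

lemma basis_eq_iff [simp]:
  "\<mu> \<in> exponents t \<Longrightarrow> \<nu> \<in> exponents t \<Longrightarrow> basis \<mu> = basis \<nu> \<longleftrightarrow> \<mu> = \<nu>"
  by (metis \<Phi>_basis monom_eq_iff)

lemma canonical_basis_eq: "canonical_basis t \<Phi> = basis ` exponents t"
  unfolding canonical_basis_def monomials_def by auto

lemma transport_order_monom_iff:
  assumes "\<mu> \<in> exponents t" "\<nu> \<in> exponents t"
  shows "(monom \<mu>, monom \<nu>) \<in> transport_order \<Phi> r \<longleftrightarrow> (basis \<mu>, basis \<nu>) \<in> r"
  unfolding transport_order_def using assms by (auto simp: eq_commute[of "monom _"])

lemma transport_order_iff: "(\<Phi> a, \<Phi> b) \<in> transport_order \<Phi> r \<longleftrightarrow> (a, b) \<in> r"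
  unfolding transport_order_def using inj_\<Phi> by (auto dest: injD)

lemma transport_order_in_TO:
  assumes "r \<in> TO (canonical_basis t \<Phi>)"
  shows "transport_order \<Phi> r \<in> TO (monomials t)"
proof -
  have r: "r \<subseteq> canonical_basis t \<Phi> \<times> canonical_basis t \<Phi>"
      "refl_on (canonical_basis t \<Phi>) r" "trans r" "antisym r" "total_on (canonical_basis t \<Phi>) r"
    using assms by (simp_all add: TO_def order_on_defs)
  have M: "monomials t = \<Phi> ` canonical_basis t \<Phi>"
    unfolding canonical_basis_eq monomials_def by (auto simp: image_image)
  have "transport_order \<Phi> r \<subseteq> monomials t \<times> monomials t"
    using r(1) unfolding transport_order_def M by auto
  moreover have "refl_on (monomials t) (transport_order \<Phi> r)"
    using r(2) unfolding refl_on_def M by (auto simp: transport_order_iff)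
  moreover have "trans (transport_order \<Phi> r)"
  proof (rule transI)
    fix x y z
    assume xy: "(x, y) \<in> transport_order \<Phi> r" and yz: "(y, z) \<in> transport_order \<Phi> r"
    obtain a b where ab: "x = \<Phi> a" "y = \<Phi> b"
      using xy by (auto simp: transport_order_def)
    obtain c where "z = \<Phi> c"
      using yz by (auto simp: transport_order_def)
    with xy yz ab r(3) show "(x, z) \<in> transport_order \<Phi> r"
      by (auto simp: transport_order_iff dest: transD)
  qed
  moreover have "antisym (transport_order \<Phi> r)"
  proof (rule antisymI)
    fix x y
    assume xy: "(x, y) \<in> transport_order \<Phi> r" and yx: "(y, x) \<in> transport_order \<Phi> r"
    obtain a b where ab: "x = \<Phi> a" "y = \<Phi> b"
      using xy by (auto simp: transport_order_def)
    with xy yx r(4) show "x = y"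
      by (auto simp: transport_order_iff dest: antisymD)
  qed
  moreover have "total_on (monomials t) (transport_order \<Phi> r)"
    using r(5) unfolding total_on_def M by (auto simp: transport_order_iff)
  ultimately show ?thesis
    by (simp add: TO_def order_on_defs)
qed

section \<open>Admissible and degree-compatible orderings as conditions on pairs\<close>

lemma CO_N_iff:
  assumes "r \<in> TO (canonical_basis t \<Phi>)"
  shows "transport_order \<Phi> r \<in> CO_M t \<longleftrightarrow>
     (\<forall>\<mu>\<in>exponents t. \<forall>\<nu>\<in>exponents t. \<forall>\<gamma>\<in>exponents t.
        (basis \<mu>, basis \<nu>) \<in> r \<longrightarrow> (basis (\<mu> + \<gamma>), basis (\<nu> + \<gamma>)) \<in> r)"
  using transport_order_in_TO[OF assms] by (simp add: CO_M_def transport_order_monom_iff)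

text \<open>Every clause concerns the membership of single pairs in \<open>r\<close>, which is the
  form from which closedness is read off later.\<close>

lemma AO_N_iff:
  "r \<in> AO_N t \<Phi> \<longleftrightarrow> r \<in> TO (canonical_basis t \<Phi>) \<and>
     (\<forall>\<mu>\<in>exponents t. \<forall>\<nu>\<in>exponents t. \<forall>\<gamma>\<in>exponents t.
        (basis \<mu>, basis \<nu>) \<in> r \<longrightarrow> (basis (\<mu> + \<gamma>), basis (\<nu> + \<gamma>)) \<in> r) \<and>
     (\<forall>\<nu>\<in>exponents t. (basis 0, basis \<nu>) \<in> r)"
  by (auto simp: AO_N_def AO_M_def CO_N_iff monomials_def transport_order_monom_iff
      simp flip: monom_zero)

text \<open>Leading monomials have full degree exactly if the ordering refines the degree. This
  replaces a condition on all polynomials by one on pairs, so that closedness becomes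
  visible.\<close>

lemma DCO_N_iff:
  "r \<in> DCO_N t \<Phi> \<longleftrightarrow> r \<in> TO (canonical_basis t \<Phi>) \<and>
     (\<forall>\<mu>\<in>exponents t. \<forall>\<nu>\<in>exponents t. \<forall>\<gamma>\<in>exponents t.
        (basis \<mu>, basis \<nu>) \<in> r \<longrightarrow> (basis (\<mu> + \<gamma>), basis (\<nu> + \<gamma>)) \<in> r) \<and>
     (\<forall>\<mu>\<in>exponents t. \<forall>\<nu>\<in>exponents t.
        exponent_degree \<mu> < exponent_degree \<nu> \<longrightarrow> (basis \<mu>, basis \<nu>) \<in> r)"
proof (cases "r \<in> TO (canonical_basis t \<Phi>)")
  case False
  then show ?thesis by (simp add: DCO_N_def)
next
  case True
  let ?q = "transport_order \<Phi> r :: 'k mpoly rel"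
  have q: "?q \<in> TO (monomials t)" by (rule transport_order_in_TO[OF True])
  have deg_monom: "total_degree (monom \<nu> :: 'k mpoly) = exponent_degree \<nu>" for \<nu>
    by (simp add: total_degree_def)
  have "(\<forall>p\<in>polys t. p \<noteq> 0 \<longrightarrow> total_degree (max_monomial ?q p) = total_degree p) \<longleftrightarrow>
    (\<forall>\<mu>\<in>exponents t. \<forall>\<nu>\<in>exponents t.
       exponent_degree \<mu> < exponent_degree \<nu> \<longrightarrow> (basis \<mu>, basis \<nu>) \<in> r)"
    (is "?L \<longleftrightarrow> ?R")
  proof
    assume L: ?L
    show ?R
    proof (intro ballI impI)
      fix \<mu> \<nu>
      assume E: "\<mu> \<in> exponents t" "\<nu> \<in> exponents t"
        and lt: "exponent_degree \<mu> < exponent_degree \<nu>"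
      \<comment> \<open>The binomial tests the pair: its leading monomial must have the larger
        degree, hence be that of \<open>\<nu>\<close>.\<close>
      define p :: "'k mpoly" where "p = monom \<mu> + monom \<nu>"
      from lt have "\<mu> \<noteq> \<nu>" by auto
      then have keys: "Poly_Mapping.keys p = {\<mu>, \<nu>}"
        by (auto simp: p_def in_keys_iff lookup_add monom_def lookup_single when_def split: if_splits)
      then have p: "p \<in> polys t" "p \<noteq> 0" using E by (auto simp: polys_def)
      obtain \<kappa> where \<kappa>: "\<kappa> \<in> Poly_Mapping.keys p" "max_monomial ?q p = monom \<kappa>"
        "\<And>\<kappa>'. \<kappa>' \<in> Poly_Mapping.keys p \<Longrightarrow> (monom \<kappa>', monom \<kappa>) \<in> ?q"
        by (rule max_monomialE[OF q p]) blast
      have "exponent_degree \<kappa> = total_degree p"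
        using L p \<kappa>(2) by (metis deg_monom)
      also have "\<dots> = exponent_degree \<nu>"
        using lt by (simp add: total_degree_def keys)
      finally have "\<kappa> = \<nu>" using \<kappa>(1) keys lt by auto
      then show "(basis \<mu>, basis \<nu>) \<in> r"
        using \<kappa>(3)[of \<mu>] keys E by (simp add: transport_order_monom_iff)
    qed
  next
    assume R: ?R
    show ?L
    proof (intro ballI impI)
      fix p :: "'k mpoly" assume p: "p \<in> polys t" "p \<noteq> 0"
      obtain \<nu> where \<nu>: "\<nu> \<in> Poly_Mapping.keys p" "max_monomial ?q p = monom \<nu>"
        "\<And>\<mu>. \<mu> \<in> Poly_Mapping.keys p \<Longrightarrow> (monom \<mu>, monom \<nu>) \<in> ?q"
        by (rule max_monomialE[OF q p]) blast
      have E: "\<mu> \<in> exponents t" if "\<mu> \<in> Poly_Mapping.keys p" for \<mu>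
        using p that by (auto simp: polys_def)
      have "exponent_degree \<mu> \<le> exponent_degree \<nu>" if \<mu>: "\<mu> \<in> Poly_Mapping.keys p" for \<mu>
      proof (rule ccontr)
        assume "\<not> ?thesis"
        \<comment> \<open>An exponent of larger degree would lie above \<open>\<nu>\<close> by the
          degree condition and below it by maximality.\<close>
        then have "(basis \<nu>, basis \<mu>) \<in> r" and "\<mu> \<noteq> \<nu>"
          using R E \<mu> \<nu>(1) by auto
        moreover have "(basis \<mu>, basis \<nu>) \<in> r"
          using \<nu>(3)[OF \<mu>] E \<mu> \<nu>(1) by (simp add: transport_order_monom_iff)
        moreover have "antisym r" using True by (simp add: TO_def order_on_defs)
        ultimately show False
          using E \<mu> \<nu>(1) by (auto dest: antisymD)
      qed
      then have "total_degree p = exponent_degree \<nu>"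
        unfolding total_degree_def using \<nu>(1) by (intro Max_eqI) auto
      then show "total_degree (max_monomial ?q p) = total_degree p"
        by (simp add: \<nu>(2) deg_monom)
    qed
  qed
  then show ?thesis
    using True by (simp add: DCO_N_def DCO_M_def CO_N_iff)
qed

text \<open>A nonzero exponent has positive degree, so the degree condition puts \<open>1\<close>
  below every other monomial.\<close>

lemma DCO_N_subset_AO_N: "DCO_N t \<Phi> \<subseteq> AO_N t \<Phi>"
proof
  fix r assume r: "r \<in> DCO_N t \<Phi>"
  have "(basis 0, basis \<nu>) \<in> r" if \<nu>: "\<nu> \<in> exponents t" for \<nu>
  proof (cases "\<nu> = 0")
    case True
    have "refl_on (canonical_basis t \<Phi>) r"
      using r by (simp add: DCO_N_iff TO_def order_on_defs)
    then show ?thesis using True by (simp add: refl_on_def canonical_basis_eq)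
  next
    case False
    then have "exponent_degree 0 < exponent_degree \<nu>"
      by (auto simp: exponent_degree_def in_keys_iff intro!: sum_pos)
    then show ?thesis using r \<nu> by (simp add: DCO_N_iff)
  qed
  then show "r \<in> AO_N t \<Phi>"
    using r by (simp add: AO_N_iff DCO_N_iff)
qed


subsection \<open>Leading exponents and division\<close>

text \<open>Exponents turn products of leading monomials into sums. The value is meaningful for
  nonzero \<open>a\<close> only.\<close>

definition lexp :: "'a rel \<Rightarrow> 'a \<Rightarrow> (nat \<Rightarrow>\<^sub>0 nat)" where
  "lexp r a = (THE \<nu>. LM \<Phi> r a = monom \<nu>)"

text \<open>The strict part of \<open>r\<close>, read on exponents. It is confined to
  \<open>exponents t\<close> because \<open>basis\<close> is arbitrary elsewhere.\<close>

definition exp_less :: "'a rel \<Rightarrow> (nat \<Rightarrow>\<^sub>0 nat) rel" where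
  "exp_less r = {(\<mu>, \<nu>). \<mu> \<in> exponents t \<and> \<nu> \<in> exponents t \<and> \<mu> \<noteq> \<nu> \<and> (basis \<mu>, basis \<nu>) \<in> r}"

text \<open>For a total ordering \<open>r\<close> of the canonical basis, these are the exponents of
  the monomials in the ideal generated by the leading monomials of \<open>G\<close>.\<close>

definition lead_multiples :: "'a rel \<Rightarrow> 'a set \<Rightarrow> (nat \<Rightarrow>\<^sub>0 nat) set" where
  "lead_multiples r G = {lexp r g + \<gamma> | g \<gamma>. g \<in> G \<and> g \<noteq> 0 \<and> \<gamma> \<in> exponents t}"

lemma keys_scale_subset: "Poly_Mapping.keys (\<Phi> (scale c a)) \<subseteq> Poly_Mapping.keys (\<Phi> a)"
  by (auto simp: \<Phi>_scale in_keys_iff)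

lemma keys_diff_subset:
  "Poly_Mapping.keys (\<Phi> (a - b)) \<subseteq> Poly_Mapping.keys (\<Phi> a) \<union> Poly_Mapping.keys (\<Phi> b)"
  by (simp add: \<Phi>_diff keys_diff)

lemma keys_add_subset:
  "Poly_Mapping.keys (\<Phi> (a + b)) \<subseteq> Poly_Mapping.keys (\<Phi> a) \<union> Poly_Mapping.keys (\<Phi> b)"
  by (simp add: \<Phi>_add keys_add)

lemma lexp_eqI:
  assumes r: "r \<in> TO (canonical_basis t \<Phi>)" and \<nu>: "\<nu> \<in> Poly_Mapping.keys (\<Phi> a)"
    and max: "\<And>\<mu>. \<mu> \<in> Poly_Mapping.keys (\<Phi> a) \<Longrightarrow> (basis \<mu>, basis \<nu>) \<in> r"
  shows "lexp r a = \<nu>" "LM \<Phi> r a = monom \<nu>"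
proof -
  have "antisym (transport_order \<Phi> r)"
    using transport_order_in_TO[OF r] by (simp add: TO_def order_on_defs)
  then show "LM \<Phi> r a = monom \<nu>"
    unfolding LM_def using \<nu> max
    by (intro max_monomial_eqI) (auto simp: transport_order_monom_iff keys_\<Phi>_exponents)
  then show "lexp r a = \<nu>" by (simp add: lexp_def)
qed

lemma lexp_max:
  assumes r: "r \<in> TO (canonical_basis t \<Phi>)" and a: "a \<noteq> 0"
  shows "lexp r a \<in> Poly_Mapping.keys (\<Phi> a)"
    and "LM \<Phi> r a = monom (lexp r a)"
    and "\<And>\<mu>. \<mu> \<in> Poly_Mapping.keys (\<Phi> a) \<Longrightarrow> (basis \<mu>, basis (lexp r a)) \<in> r"
proof -
  have "\<Phi> a \<noteq> 0" using a by simp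
  then obtain \<nu> where \<nu>: "\<nu> \<in> Poly_Mapping.keys (\<Phi> a)" "LM \<Phi> r a = monom \<nu>"
    "\<And>\<mu>. \<mu> \<in> Poly_Mapping.keys (\<Phi> a) \<Longrightarrow> (monom \<mu>, monom \<nu>) \<in> transport_order \<Phi> r"
    unfolding LM_def
    using max_monomialE[OF transport_order_in_TO[OF r] \<Phi>_in_polys] by blast
  moreover from \<nu>(2) have "lexp r a = \<nu>" by (simp add: lexp_def)
  ultimately show "lexp r a \<in> Poly_Mapping.keys (\<Phi> a)" "LM \<Phi> r a = monom (lexp r a)"
    "\<And>\<mu>. \<mu> \<in> Poly_Mapping.keys (\<Phi> a) \<Longrightarrow> (basis \<mu>, basis (lexp r a)) \<in> r"
    by (simp_all add: transport_order_monom_iff keys_\<Phi>_exponents)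
qed

lemma lexp_exponents: "r \<in> TO (canonical_basis t \<Phi>) \<Longrightarrow> a \<noteq> 0 \<Longrightarrow> lexp r a \<in> exponents t"
  using lexp_max(1) keys_\<Phi>_exponents by blast

lemma AO_N_TO: "r \<in> AO_N t \<Phi> \<Longrightarrow> r \<in> TO (canonical_basis t \<Phi>)"
  by (simp add: AO_N_iff)

lemma TO_refl: "r \<in> TO (canonical_basis t \<Phi>) \<Longrightarrow> \<nu> \<in> exponents t \<Longrightarrow> (basis \<nu>, basis \<nu>) \<in> r"
  by (auto simp: TO_def order_on_defs refl_on_def canonical_basis_eq)

lemma exp_le_less_trans:
  assumes r: "r \<in> TO (canonical_basis t \<Phi>)"
    and "(basis \<mu>, basis \<nu>) \<in> r" "(\<nu>, \<kappa>) \<in> exp_less r" "\<mu> \<in> exponents t"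
  shows "(\<mu>, \<kappa>) \<in> exp_less r"
proof -
  have r': "trans r" "antisym r" using r by (simp_all add: TO_def order_on_defs)
  have \<nu>\<kappa>: "\<nu> \<in> exponents t" "\<kappa> \<in> exponents t" "\<nu> \<noteq> \<kappa>" "(basis \<nu>, basis \<kappa>) \<in> r"
    using assms(3) by (simp_all add: exp_less_def)
  have "(basis \<mu>, basis \<kappa>) \<in> r" by (rule transD[OF r'(1) assms(2) \<nu>\<kappa>(4)])
  moreover have "\<mu> \<noteq> \<kappa>"
    using antisymD[OF r'(2) \<nu>\<kappa>(4)] assms(2) \<nu>\<kappa>(1-3) by auto
  ultimately show ?thesis using \<nu>\<kappa>(2) assms(4) by (simp add: exp_less_def)
qed

lemma lexp_basis:
  assumes "r \<in> TO (canonical_basis t \<Phi>)" "\<nu> \<in> exponents t"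
  shows "lexp r (basis \<nu>) = \<nu>"
  using assms by (intro lexp_eqI) (simp_all add: TO_refl)

text \<open>In an infinite descending chain some term would be a multiple of an earlier one by
  \<open>dickson_sequence\<close>, but multiples are never smaller in an admissible
  ordering.\<close>

lemma wf_exp_less:
  assumes r: "r \<in> AO_N t \<Phi>"
  shows "wf (exp_less r)"
  unfolding wf_iff_no_infinite_down_chain
proof
  assume "\<exists>f. \<forall>i. (f (Suc i), f i) \<in> exp_less r"
  then obtain f where f: "\<And>i. (f (Suc i), f i) \<in> exp_less r" by blast
  then have E: "f i \<in> exponents t" for i
    using f[of i] by (simp add: exp_less_def)
  have less: "(f (m + Suc k), f m) \<in> exp_less r" for m k
  proof (induction k)
    case 0
    then show ?case using f by simp
  next
    case (Suc k)
    have "(f (Suc (m + Suc k)), f (m + Suc k)) \<in> exp_less r" by (rule f)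
    then have "(basis (f (m + Suc (Suc k))), basis (f (m + Suc k))) \<in> r"
      by (simp add: exp_less_def)
    then show ?case using exp_le_less_trans[OF AO_N_TO[OF r] _ Suc E] by blast
  qed
  obtain m n \<gamma> where mn: "m < n" "\<gamma> \<in> exponents t" "f n = f m + \<gamma>"
    using dickson_sequence[of f t] E by blast
  \<comment> \<open>This is \<open>1 \<le> X^\<gamma>\<close> multiplied by the monomial with
    exponent \<open>f m\<close>.\<close>
  have "(basis (0 + f m), basis (\<gamma> + f m)) \<in> r"
    using r mn(2) E unfolding AO_N_iff by (meson zero_in_exponents)
  then have "(basis (f m), basis (f n)) \<in> r"
    using mn(3) by (simp add: add.commute)
  moreover obtain k where "n = m + Suc k" using mn(1) less_imp_Suc_add by auto
  ultimately have "(f m, f m) \<in> exp_less r"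
    using less[of m k] exp_le_less_trans[OF AO_N_TO[OF r]] E by blast
  then show False by (simp add: exp_less_def)
qed

lemma lexp_mult:
  assumes r: "r \<in> TO (canonical_basis t \<Phi>)" and mult: "multiplicative_on \<Phi> {r}"
    and "a \<noteq> 0" "b \<noteq> 0"
  shows "a * b \<noteq> 0" "lexp r (a * b) = lexp r a + lexp r b"
proof -
  show ab: "a * b \<noteq> 0" using mult assms(3,4) unfolding multiplicative_on_def by blast
  have "LM \<Phi> r (a * b) = LM \<Phi> r a * LM \<Phi> r b"
    using mult assms(3,4) unfolding multiplicative_on_def by blast
  then have "(monom (lexp r (a * b)) :: 'k mpoly) = monom (lexp r a + lexp r b)"
    using lexp_max(2)[OF r] ab assms(3,4) by (simp add: monom_add)
  then show "lexp r (a * b) = lexp r a + lexp r b" by simp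
qed

text \<open>One reduction step: with \<open>c\<close> the quotient of the two leading coefficients
  the common leading term cancels, and all other terms are smaller.\<close>

lemma cancel_lead:
  assumes r: "r \<in> TO (canonical_basis t \<Phi>)" and "a \<noteq> 0" "b \<noteq> 0" "lexp r b = lexp r a"
  shows "\<exists>c. \<forall>\<mu>\<in>Poly_Mapping.keys (\<Phi> (a - scale c b)). (\<mu>, lexp r a) \<in> exp_less r"
proof -
  let ?\<nu> = "lexp r a"
  define c where "c = Poly_Mapping.lookup (\<Phi> a) ?\<nu> / Poly_Mapping.lookup (\<Phi> b) ?\<nu>"
  have "?\<nu> \<in> Poly_Mapping.keys (\<Phi> b)"
    using lexp_max(1)[OF r, of b] assms by simp
  then have 0: "Poly_Mapping.lookup (\<Phi> (a - scale c b)) ?\<nu> = 0"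
    by (simp add: \<Phi>_diff \<Phi>_scale lookup_minus c_def in_keys_iff)
  have "(\<mu>, ?\<nu>) \<in> exp_less r" if \<mu>: "\<mu> \<in> Poly_Mapping.keys (\<Phi> (a - scale c b))" for \<mu>
  proof -
    have "\<mu> \<noteq> ?\<nu>" using 0 \<mu> by (auto simp: in_keys_iff)
    moreover have "\<mu> \<in> Poly_Mapping.keys (\<Phi> a) \<union> Poly_Mapping.keys (\<Phi> b)"
      using \<mu> keys_diff_subset[of a "scale c b"] keys_scale_subset[of c b] by blast
    then have "(basis \<mu>, basis ?\<nu>) \<in> r"
      using lexp_max(3)[OF r, of a] lexp_max(3)[OF r, of b] assms by auto
    ultimately show ?thesis
      using \<mu> assms(2) by (simp add: exp_less_def keys_\<Phi>_exponents lexp_exponents[OF r])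
  qed
  then show ?thesis by blast
qed

text \<open>A scalar \<open>c\<close> acts as left multiplication by
  \<open>scale c 1\<close>.\<close>

lemma left_ideal_scale: "left_ideal L \<Longrightarrow> x \<in> L \<Longrightarrow> scale c x \<in> L"
  unfolding left_ideal_def by (metis mult_1 scale_mult_left)

lemma left_ideal_diff: "left_ideal L \<Longrightarrow> x \<in> L \<Longrightarrow> y \<in> L \<Longrightarrow> x - y \<in> L"
  unfolding left_ideal_def by (metis add_uminus_conv_diff mult_minus1)

text \<open>Well-founded induction on the leading exponent, where \<open>l\<close> collects the
  terms that can be reduced by \<open>G\<close>. The bound on the exponents of \<open>l\<close>
  carries the last clause: an irreducible leading term is never cancelled later, so it survives in
  the remainder.\<close>

lemma division:
  assumes r: "r \<in> AO_N t \<Phi>" and mult: "multiplicative_on \<Phi> {r}"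
    and J: "left_ideal J" and G: "G \<subseteq> J"
  shows "\<exists>l\<in>J. Poly_Mapping.keys (\<Phi> (a - l)) \<inter> lead_multiples r G = {} \<and>
     (\<forall>\<mu>\<in>Poly_Mapping.keys (\<Phi> l). \<exists>\<kappa>\<in>Poly_Mapping.keys (\<Phi> a). (basis \<mu>, basis \<kappa>) \<in> r) \<and>
     (a \<noteq> 0 \<and> lexp r a \<notin> lead_multiples r G \<longrightarrow> lexp r a \<in> Poly_Mapping.keys (\<Phi> (a - l)))"
    (is "\<exists>l\<in>J. ?P a l")
proof -
  have J0: "0 \<in> J" using J by (simp add: left_ideal_def)
  note TO = AO_N_TO[OF r]
  \<comment> \<open>Zero has no leading exponent; it is kept out of the induction and treated at the
    end with \<open>l = 0\<close>.\<close>
  have "a \<noteq> 0 \<Longrightarrow> \<exists>l\<in>J. ?P a l"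
  proof (induction "lexp r a" arbitrary: a rule: wf_induct_rule[OF wf_exp_less[OF r]])
    case less: 1
    let ?\<nu> = "lexp r a"
    have \<nu>: "?\<nu> \<in> Poly_Mapping.keys (\<Phi> a)" "?\<nu> \<in> exponents t"
      using lexp_max(1)[OF TO] lexp_exponents[OF TO] less.prems by auto
    \<comment> \<open>\<open>b\<close> shares the leading exponent of \<open>a\<close>: a left
      multiple of an element of \<open>G\<close> if that exponent is reducible, a basis element
      otherwise.\<close>
    obtain b where b: "b \<noteq> 0" "lexp r b = ?\<nu>"
      "?\<nu> \<in> lead_multiples r G \<longrightarrow> b \<in> J" "?\<nu> \<notin> lead_multiples r G \<longrightarrow> b = basis ?\<nu>"
    proof (cases "?\<nu> \<in> lead_multiples r G")
      case True
      then obtain g \<gamma> where g: "?\<nu> = lexp r g + \<gamma>" "g \<in> G" "g \<noteq> 0" "\<gamma> \<in> exponents t"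
        by (auto simp: lead_multiples_def)
      have "basis \<gamma> * g \<in> J" using J G g(2) unfolding left_ideal_def by blast
      moreover have "basis \<gamma> * g \<noteq> 0" "lexp r (basis \<gamma> * g) = ?\<nu>"
        using lexp_mult[OF TO mult, of "basis \<gamma>" g] g
        by (simp_all add: lexp_basis[OF TO] add.commute)
      ultimately show ?thesis using that True by blast
    next
      case False
      then show ?thesis using that[of "basis ?\<nu>"] \<nu>(2) lexp_basis[OF TO] by simp
    qed
    obtain c where c: "\<And>\<mu>. \<mu> \<in> Poly_Mapping.keys (\<Phi> (a - scale c b)) \<Longrightarrow> (\<mu>, ?\<nu>) \<in> exp_less r"
      using cancel_lead[OF TO less.prems b(1,2)] by blast
    let ?a = "a - scale c b"
    have "\<exists>l\<in>J. ?P ?a l"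
    proof (cases "?a = 0")
      case True
      then show ?thesis using J0 by (intro bexI[of _ 0]) auto
    next
      case False
      then show ?thesis using less.hyps[of ?a] c lexp_max(1)[OF TO] by blast
    qed
    then obtain l where l: "l \<in> J" "Poly_Mapping.keys (\<Phi> (?a - l)) \<inter> lead_multiples r G = {}"
      "\<And>\<mu>. \<mu> \<in> Poly_Mapping.keys (\<Phi> l) \<Longrightarrow>
         \<exists>\<kappa>\<in>Poly_Mapping.keys (\<Phi> ?a). (basis \<mu>, basis \<kappa>) \<in> r"
      by blast
    have l_less: "(\<mu>, ?\<nu>) \<in> exp_less r" if "\<mu> \<in> Poly_Mapping.keys (\<Phi> l)" for \<mu>
      using l(3)[OF that] c exp_le_less_trans[OF TO] keys_\<Phi>_exponents[OF that] by blast
    show ?case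
    proof (cases "?\<nu> \<in> lead_multiples r G")
      case True
      \<comment> \<open>The cancelled term lies in \<open>J\<close> and joins \<open>l\<close>; the
        remainder is that of \<open>?a\<close>.\<close>
      have "(basis \<mu>, basis ?\<nu>) \<in> r" if "\<mu> \<in> Poly_Mapping.keys (\<Phi> (scale c b + l))" for \<mu>
        using that keys_add_subset[of "scale c b" l] keys_scale_subset[of c b] l_less
          lexp_max(3)[OF TO b(1)] b(2) by (auto simp: exp_less_def)
      moreover have "scale c b + l \<in> J"
        using J b(3) True l(1) left_ideal_scale[OF J] by (simp add: left_ideal_def)
      ultimately show ?thesis
        using True l(2) \<nu>(1) by (intro bexI[of _ "scale c b + l"]) (auto simp: algebra_simps)
    next
      case False
      \<comment> \<open>Here the cancelled term goes back into the remainder and \<open>l\<close>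
        stays the same.\<close>
      have "a - l = (?a - l) + scale c b" by simp
      then have "Poly_Mapping.keys (\<Phi> (a - l)) \<subseteq>
          Poly_Mapping.keys (\<Phi> (?a - l)) \<union> Poly_Mapping.keys (\<Phi> b)"
        using keys_add_subset[of "?a - l" "scale c b"] keys_scale_subset[of c b] by auto
      then have "Poly_Mapping.keys (\<Phi> (a - l)) \<inter> lead_multiples r G = {}"
        using l(2) False b(4) \<nu>(2) by auto
      moreover have "?\<nu> \<notin> Poly_Mapping.keys (\<Phi> l)"
        using l_less[of ?\<nu>] by (auto simp: exp_less_def)
      then have "?\<nu> \<in> Poly_Mapping.keys (\<Phi> (a - l))"
        using \<nu>(1) by (simp add: \<Phi>_diff lookup_minus in_keys_iff)
      ultimately show ?thesis
        using l(1) l_less \<nu>(1) by (intro bexI[of _ l]) (auto simp: exp_less_def)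
    qed
  qed
  then show ?thesis
    using J0 by (cases "a = 0") (auto intro!: bexI[of _ 0])
qed

section \<open>Change of ordering and a criterion for Groebner bases\<close>

lemma lead_multiples_cong:
  "(\<And>g. g \<in> G \<Longrightarrow> g \<noteq> 0 \<Longrightarrow> lexp s g = lexp r g) \<Longrightarrow> lead_multiples s G = lead_multiples r G"
  unfolding lead_multiples_def by (intro Collect_cong ex_cong1) auto

lemma lead_multiples_mono: "G \<subseteq> H \<Longrightarrow> lead_multiples r G \<subseteq> lead_multiples r H"
  unfolding lead_multiples_def by blast

text \<open>The remainder is produced by \<open>s\<close>-division but tested with \<open>r\<close>.
  It is nonzero because an irreducible \<open>s\<close>-leading term of \<open>h\<close> survives in
  it.\<close>

lemma leads_transfer:
  assumes s: "s \<in> AO_N t \<Phi>" and mult: "multiplicative_on \<Phi> {s}" and r: "r \<in> AO_N t \<Phi>"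
    and L: "left_ideal L" and G: "G \<subseteq> L"
    and leads: "\<And>h. h \<in> L \<Longrightarrow> h \<noteq> 0 \<Longrightarrow> lexp r h \<in> lead_multiples r G"
    and eq: "\<And>g. g \<in> G \<Longrightarrow> g \<noteq> 0 \<Longrightarrow> lexp s g = lexp r g"
    and h: "h \<in> L" "h \<noteq> 0"
  shows "lexp s h \<in> lead_multiples s G"
proof (rule ccontr)
  assume no: "lexp s h \<notin> lead_multiples s G"
  obtain l where l: "l \<in> L" "Poly_Mapping.keys (\<Phi> (h - l)) \<inter> lead_multiples s G = {}"
    "lexp s h \<in> Poly_Mapping.keys (\<Phi> (h - l))"
    using division[OF s mult L G, of h] no h(2) by blast
  from l(3) have "h - l \<noteq> 0" by auto
  moreover have "h - l \<in> L" by (rule left_ideal_diff[OF L h(1) l(1)])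
  ultimately have "lexp r (h - l) \<in> lead_multiples r G"
    "lexp r (h - l) \<in> Poly_Mapping.keys (\<Phi> (h - l))"
    using leads lexp_max(1)[OF AO_N_TO[OF r]] by auto
  then show False using l(2) lead_multiples_cong[of G s r] eq by auto
qed

text \<open>Allows division to be carried out inside the span of \<open>G\<close>.\<close>

lemma left_ideal_span:
  "left_ideal {\<Sum>g\<in>G. c g * g | c. True}" for G :: "'a set"
proof -
  let ?J = "{\<Sum>g\<in>G. c g * g | c. True}"
  have "0 \<in> ?J" by (auto intro!: exI[of _ "\<lambda>_. 0"])
  moreover have "x + y \<in> ?J" if x: "x \<in> ?J" and y: "y \<in> ?J" for x y
  proof -
    obtain c d where "x = (\<Sum>g\<in>G. c g * g)" "y = (\<Sum>g\<in>G. d g * g)" using x y by blast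
    then show ?thesis
      by (auto intro!: exI[of _ "\<lambda>g. c g + d g"] simp: distrib_right sum.distrib)
  qed
  moreover have "a * x \<in> ?J" if x: "x \<in> ?J" for a x
  proof -
    obtain c where "x = (\<Sum>g\<in>G. c g * g)" using x by blast
    then show ?thesis
      by (auto intro!: exI[of _ "\<lambda>g. a * c g"] simp: sum_distrib_left mult.assoc)
  qed
  ultimately show ?thesis unfolding left_ideal_def by blast
qed

text \<open>Reduces both requirements on a Groebner basis, generation of \<open>L\<close> and
  equality of the leading ideals, to divisibility of leading exponents.\<close>

lemma groebner_basisI:
  assumes r: "r \<in> AO_N t \<Phi>" and mult: "multiplicative_on \<Phi> {r}"
    and L: "left_ideal L" and G: "finite G" "G \<subseteq> L"
    and leads: "\<And>h. h \<in> L \<Longrightarrow> h \<noteq> 0 \<Longrightarrow> lexp r h \<in> lead_multiples r G"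
  shows "groebner_basis t \<Phi> r L G"
proof -
  note TO = AO_N_TO[OF r]
  let ?J = "{\<Sum>g\<in>G. c g * g | c. True}"
  have GJ: "G \<subseteq> ?J"
  proof
    fix g assume g: "g \<in> G"
    have "g = (\<Sum>x\<in>G. (if x = g then 1 else 0) * x)"
      using g G(1) by (simp add: if_distrib[of "\<lambda>x. x * _"] cong: if_cong)
    then show "g \<in> ?J" by (auto intro!: exI[of _ "\<lambda>x. if x = g then 1 else 0"])
  qed
  have JL: "?J \<subseteq> L"
  proof
    fix x assume "x \<in> ?J"
    then obtain c where x: "x = (\<Sum>g\<in>G. c g * g)" by blast
    have "(\<Sum>g\<in>H. c g * g) \<in> L" if "H \<subseteq> G" for H
      using finite_subset[OF that G(1)] that
      by (induction H rule: finite_induct) (use L G(2) in \<open>auto simp: left_ideal_def\<close>)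
    then show "x \<in> L" by (simp add: x)
  qed
  have "L \<subseteq> ?J"
  proof
    fix h assume h: "h \<in> L"
    \<comment> \<open>Dividing inside \<open>?J\<close> makes \<open>l\<close> a combination of
      \<open>G\<close>. The remainder lies in \<open>L\<close>, so if it were nonzero its leading
      exponent would be reducible.\<close>
    obtain l where l: "l \<in> ?J" "Poly_Mapping.keys (\<Phi> (h - l)) \<inter> lead_multiples r G = {}"
      using division[OF r mult left_ideal_span GJ, of h] by blast
    have "h - l \<in> L" using left_ideal_diff[OF L h] l(1) JL by blast
    then have "h - l = 0"
      using leads[of "h - l"] lexp_max(1)[OF TO, of "h - l"] l(2) by auto
    then show "h \<in> ?J" using l(1) by simp
  qed
  then have "L = ?J" using JL by blast
  \<comment> \<open>The two hulls agree because the same ideals contain both generating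
    sets.\<close>
  moreover have "LM \<Phi> r ` (G - {0}) \<subseteq> I \<longleftrightarrow> LM \<Phi> r ` (L - {0}) \<subseteq> I" if I: "poly_ideal t I" for I
  proof
    assume GI: "LM \<Phi> r ` (G - {0}) \<subseteq> I"
    show "LM \<Phi> r ` (L - {0}) \<subseteq> I"
    proof
      fix m assume "m \<in> LM \<Phi> r ` (L - {0})"
      then obtain h where h: "h \<in> L" "h \<noteq> 0" "m = LM \<Phi> r h" by blast
      then obtain g \<gamma> where g: "lexp r h = lexp r g + \<gamma>" "g \<in> G" "g \<noteq> 0" "\<gamma> \<in> exponents t"
        using leads unfolding lead_multiples_def by blast
      then have "m = monom \<gamma> * LM \<Phi> r g"
        using h lexp_max(2)[OF TO] by (simp add: monom_add mult.commute)
      then show "m \<in> I" using I GI g unfolding poly_ideal_def by auto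
    qed
  qed (use G(2) in blast)
  then have "LM_ideal t \<Phi> r L = LM_ideal t \<Phi> r G"
    unfolding LM_ideal_def hull_def by (intro arg_cong[of _ _ Inter]) blast
  ultimately show ?thesis using G by (simp add: groebner_basis_def)
qed


subsection \<open>Universal Groebner bases of compact sets of orderings\<close>

text \<open>\<open>dickson\<close> selects finitely many leading exponents that divide all others;
  \<open>G\<close> consists of elements of \<open>L\<close> realising them.\<close>

lemma leads_finite:
  assumes r: "r \<in> AO_N t \<Phi>"
  obtains G where "finite G" "G \<subseteq> L" "\<And>h. h \<in> L \<Longrightarrow> h \<noteq> 0 \<Longrightarrow> lexp r h \<in> lead_multiples r G"
proof -
  have "lexp r ` (L - {0}) \<subseteq> exponents t"
    using lexp_exponents[OF AO_N_TO[OF r]] by blast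
  then obtain F where F: "finite F" "F \<subseteq> lexp r ` (L - {0})"
    "\<forall>\<nu>\<in>lexp r ` (L - {0}). \<exists>\<mu>\<in>F. \<exists>\<gamma>\<in>exponents t. \<nu> = \<mu> + \<gamma>"
    using dickson by meson
  from F(1,2) obtain G where G: "G \<subseteq> L - {0}" "finite G" "F = lexp r ` G"
    using finite_subset_image by meson
  have "lexp r h \<in> lead_multiples r G" if "h \<in> L" "h \<noteq> 0" for h
    using F(3) G(1,3) that unfolding lead_multiples_def by blast
  then show ?thesis using that[of G] G(1,2) by blast
qed

text \<open>The leading exponents of \<open>G\<close> are fixed by finitely many comparisons, namely
  of each term of \<open>g\<close> with its \<open>r\<close>-leading term. Each comparison defines a
  subbasic open set.\<close>

lemma openin_same_leads:
  assumes r: "r \<in> TO (canonical_basis t \<Phi>)" and G: "finite G"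
  obtains U where "openin (TO_topology (canonical_basis t \<Phi>)) U" "r \<in> U"
    "\<And>s g. s \<in> U \<Longrightarrow> g \<in> G \<Longrightarrow> g \<noteq> 0 \<Longrightarrow> lexp s g = lexp r g"
proof -
  let ?N = "canonical_basis t \<Phi>"
  define P where "P = (\<Union>g\<in>G - {0}. (\<lambda>\<mu>. (basis \<mu>, basis (lexp r g))) ` Poly_Mapping.keys (\<Phi> g))"
  \<comment> \<open>The factor \<open>TO ?N\<close> matters when \<open>P\<close> is empty, since
    the intersection over \<open>P\<close> is then \<open>UNIV\<close>.\<close>
  define U where "U = TO ?N \<inter> (\<Inter>(a, b)\<in>P. {s \<in> TO ?N. (a, b) \<in> s})"
  have P: "finite P" "P \<subseteq> ?N \<times> ?N"
    using G lexp_exponents[OF r] keys_\<Phi>_exponents by (auto simp: P_def canonical_basis_eq)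
  have "openin (TO_topology ?N) (TO ?N)"
    unfolding TO_topology_def by (rule topology_generated_by_Basis) simp
  moreover have "openin (TO_topology ?N) {s \<in> TO ?N. (a, b) \<in> s}" if "(a, b) \<in> P" for a b
    unfolding TO_topology_def by (rule topology_generated_by_Basis) (use P(2) that in blast)
  ultimately have "openin (TO_topology ?N) U"
    unfolding U_def using P(1) by (cases "P = {}") (auto intro!: openin_Int openin_INT2)
  moreover have "r \<in> U"
    using r lexp_max(3)[OF r] by (auto simp: U_def P_def)
  moreover have "lexp s g = lexp r g" if s: "s \<in> U" and g: "g \<in> G" "g \<noteq> 0" for s g
  proof (rule lexp_eqI)
    show "s \<in> TO ?N" using s by (simp add: U_def)
    show "lexp r g \<in> Poly_Mapping.keys (\<Phi> g)" by (rule lexp_max(1)[OF r g(2)])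
    show "(basis \<mu>, basis (lexp r g)) \<in> s" if \<mu>: "\<mu> \<in> Poly_Mapping.keys (\<Phi> g)" for \<mu>
    proof -
      have "(basis \<mu>, basis (lexp r g)) \<in> P" using g \<mu> by (auto simp: P_def)
      then show ?thesis using s by (auto simp: U_def)
    qed
  qed
  ultimately show ?thesis using that by blast
qed

text \<open>Near each ordering one finite set keeps dividing all leading exponents. Finitely many
  such neighbourhoods cover \<open>T\<close>, and enlarging a set only enlarges its
  \<open>lead_multiples\<close>, so the union serves all orderings at once.\<close>

lemma universal_groebner_basis_compact:
  assumes T: "compactin (TO_topology (canonical_basis t \<Phi>)) T" "T \<subseteq> AO_N t \<Phi>"
    and mult: "multiplicative_on \<Phi> T" and L: "left_ideal L"
  shows "\<exists>G. universal_groebner_basis t \<Phi> T L G"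
proof -
  let ?X = "TO_topology (canonical_basis t \<Phi>)"
  have mult1: "multiplicative_on \<Phi> {r}" if "r \<in> T" for r
    using mult that by (auto simp: multiplicative_on_def)
  have "\<exists>G U. finite G \<and> G \<subseteq> L \<and> openin ?X U \<and> r \<in> U \<and>
      (\<forall>s\<in>U \<inter> T. \<forall>h\<in>L. h \<noteq> 0 \<longrightarrow> lexp s h \<in> lead_multiples s G)" if r: "r \<in> T" for r
  proof -
    from r T(2) have AO: "r \<in> AO_N t \<Phi>" by blast
    obtain G where G: "finite G" "G \<subseteq> L"
      "\<And>h. h \<in> L \<Longrightarrow> h \<noteq> 0 \<Longrightarrow> lexp r h \<in> lead_multiples r G"
      using leads_finite[OF AO] by metis
    obtain U where U: "openin ?X U" "r \<in> U"
      "\<And>s g. s \<in> U \<Longrightarrow> g \<in> G \<Longrightarrow> g \<noteq> 0 \<Longrightarrow> lexp s g = lexp r g"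
      using openin_same_leads[OF AO_N_TO[OF AO] G(1)] by metis
    have "lexp s h \<in> lead_multiples s G" if "s \<in> U \<inter> T" "h \<in> L" "h \<noteq> 0" for s h
      using that T(2) U(3) by (intro leads_transfer[OF _ mult1 AO L G(2,3)]) auto
    then show ?thesis using G U by blast
  qed
  then obtain G U where GU: "\<And>r. r \<in> T \<Longrightarrow> finite (G r) \<and> G r \<subseteq> L \<and> openin ?X (U r) \<and> r \<in> U r \<and>
      (\<forall>s\<in>U r \<inter> T. \<forall>h\<in>L. h \<noteq> 0 \<longrightarrow> lexp s h \<in> lead_multiples s (G r))"
    by metis
  obtain \<F> where \<F>: "finite \<F>" "\<F> \<subseteq> U ` T" "T \<subseteq> \<Union>\<F>"
    using compactinD[OF T(1), of "U ` T"] GU by blast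
  then obtain R where R: "R \<subseteq> T" "finite R" "\<F> = U ` R"
    using finite_subset_image by meson
  define H where "H = (\<Union>r\<in>R. G r)"
  have "finite (G r) \<and> G r \<subseteq> L" if "r \<in> R" for r using R(1) GU that by blast
  then have H: "finite H" "H \<subseteq> L" using R(2) unfolding H_def by blast+
  have "groebner_basis t \<Phi> s L H" if s: "s \<in> T" for s
  proof (rule groebner_basisI[OF _ mult1[OF s] L H])
    show "s \<in> AO_N t \<Phi>" using s T(2) by blast
    obtain r where r: "r \<in> R" "s \<in> U r" using s \<F>(3) R(3) by blast
    have "lead_multiples s (G r) \<subseteq> lead_multiples s H"
      using r(1) by (intro lead_multiples_mono) (auto simp: H_def)
    then show "lexp s h \<in> lead_multiples s H" if "h \<in> L" "h \<noteq> 0" for h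
      using GU[of r] r R(1) s that by blast
  qed
  then show ?thesis using H by (auto simp: universal_groebner_basis_def)
qed

end

subsection \<open>Compactness of spaces of orderings\<close>

text \<open>Evaluation at \<open>p\<close> is continuous for the product topology, and
  \<open>bool\<close> is discrete.\<close>

lemma open_Collect_coordinate: "open {f :: 'b \<Rightarrow> bool. f p}"
proof -
  have "open ((\<lambda>f :: 'b \<Rightarrow> bool. f p) -` {True})"
    by (rule open_vimage) (simp_all add: open_discrete)
  moreover have "(\<lambda>f :: 'b \<Rightarrow> bool. f p) -` {True} = {f. f p}" by auto
  ultimately show ?thesis by metis
qed

lemma closed_Collect_coordinate: "closed {f :: 'b \<Rightarrow> bool. f p}"
proof -
  have "closed ((\<lambda>f :: 'b \<Rightarrow> bool. f p) -` {True})"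
    by (rule closed_vimage) (simp_all add: closed_def open_discrete)
  moreover have "(\<lambda>f :: 'b \<Rightarrow> bool. f p) -` {True} = {f. f p}" by auto
  ultimately show ?thesis by metis
qed

text \<open>These rules prove closedness of universally quantified conditions on coordinates. The
  premise of an implication has to be open, which coordinates and constants are.\<close>

lemmas closed_Collect_relation =
  closed_Collect_all closed_Collect_imp closed_Collect_conj closed_Collect_disj closed_Collect_const
  open_Collect_const open_Collect_coordinate closed_Collect_coordinate

text \<open>A relation is encoded by its characteristic function, a point of a product of two-point
  spaces. Each axiom of a linear order is a universal condition on finitely many
  coordinates.\<close>

lemma closed_TO: "closed {f :: 's \<times> 's \<Rightarrow> bool. Collect f \<in> TO S}"
  unfolding TO_def order_on_defs refl_on_def trans_def antisym_def total_on_def subset_eq Ball_def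
    mem_Collect_eq
  by (intro closed_Collect_relation)

lemma compactin_TO_topology:
  assumes TO: "T \<subseteq> TO S" and closed: "closed {f :: 's \<times> 's \<Rightarrow> bool. Collect f \<in> T}"
  shows "compactin (TO_topology S) T"
proof -
  define W where "W = {f :: 's \<times> 's \<Rightarrow> bool. Collect f \<in> T}"
  \<comment> \<open>Tychonoff's theorem; each factor \<open>bool\<close> is finite.\<close>
  have "compact_space (euclidean :: ('s \<times> 's \<Rightarrow> bool) topology)"
    unfolding euclidean_product_topology[symmetric] compact_space_product_topology
    by (simp add: compact_space_def finite_imp_compact)
  then have "compact (UNIV :: ('s \<times> 's \<Rightarrow> bool) set)"
    by (simp add: compact_space_def)
  then have W: "compactin (subtopology euclidean W) W"
    using compact_Int_closed[of UNIV W] closed by (simp add: W_def)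
  have "continuous_map (subtopology euclidean W) (TO_topology S) Collect"
    unfolding TO_topology_def
  \<comment> \<open>Only subbasic sets need checking: \<open>TO S\<close> pulls back to all of
    \<open>W\<close>, the others to traces of open coordinate sets.\<close>
  proof (rule continuous_on_generated_topo)
    fix U assume "U \<in> insert (TO S) {{r \<in> TO S. (a, b) \<in> r} | a b. a \<in> S \<and> b \<in> S}"
    then consider "U = TO S" | a b where "U = {r \<in> TO S. (a, b) \<in> r}" by blast
    then show "openin (subtopology euclidean W) (Collect -` U \<inter> topspace (subtopology euclidean W))"
    proof cases
      case 1
      then have "Collect -` U \<inter> W = W" using TO by (auto simp: W_def)
      then show ?thesis using openin_topspace[of "subtopology euclidean W"] by simp
    next
      case 2
      then have "Collect -` U \<inter> W = W \<inter> {f. f (a, b)}" using TO by (auto simp: W_def)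
      then show ?thesis using openin_open_Int[OF open_Collect_coordinate] by simp
    qed
  qed (use TO in \<open>auto simp: W_def\<close>)
  from image_compactin[OF W this] have "compactin (TO_topology S) (Collect ` W)" .
  moreover have "Collect ` W = T"
  proof
    show "T \<subseteq> Collect ` W"
    proof
      fix r assume "r \<in> T"
      then show "r \<in> Collect ` W"
        by (intro image_eqI[of _ _ "\<lambda>p. p \<in> r"]) (simp_all add: W_def)
    qed
  qed (auto simp: W_def)
  ultimately show ?thesis by simp
qed

context countable_type_algebra
begin

lemma compactin_AO_N: "compactin (TO_topology (canonical_basis t \<Phi>)) (AO_N t \<Phi>)"
  by (rule compactin_TO_topology)
    (unfold AO_N_iff Ball_def subset_eq mem_Collect_eq,
     blast, intro closed_Collect_relation closed_TO)

text \<open>The degree comparisons in \<open>DCO_N_iff\<close> do not depend on the ordering, so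
  they enter as constants and the condition is closed.\<close>

lemma compactin_DCO_N: "compactin (TO_topology (canonical_basis t \<Phi>)) (DCO_N t \<Phi>)"
  by (rule compactin_TO_topology)
    (unfold DCO_N_iff Ball_def subset_eq mem_Collect_eq,
     blast, intro closed_Collect_relation closed_TO)

end

theorem corollary10p5:
  fixes scale :: "'k::field \<Rightarrow> 'a::ring_1 \<Rightarrow> 'a"
    and t :: nat
    and \<Phi> :: "'a \<Rightarrow> 'k mpoly"
  assumes "countable_type_algebra scale t \<Phi>"
  shows "(\<forall>T. T \<noteq> {} \<and>
             closedin (subtopology (TO_topology (canonical_basis t \<Phi>)) (AO_N t \<Phi>)) T \<and>
             multiplicative_on \<Phi> T \<longrightarrow>
             (\<forall>L. left_ideal L \<longrightarrow> (\<exists>G. universal_groebner_basis t \<Phi> T L G))) \<and>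
         (multiplicative_on \<Phi> (AO_N t \<Phi>) \<longrightarrow>
             (\<forall>L. left_ideal L \<longrightarrow> (\<exists>G. universal_groebner_basis t \<Phi> (AO_N t \<Phi>) L G))) \<and>
         (multiplicative_on \<Phi> (DCO_N t \<Phi>) \<longrightarrow>
             (\<forall>L. left_ideal L \<longrightarrow> (\<exists>G. universal_groebner_basis t \<Phi> (DCO_N t \<Phi>) L G)))"
proof -
  interpret countable_type_algebra scale t \<Phi> by (rule assms)
  let ?X = "TO_topology (canonical_basis t \<Phi>)"
  \<comment> \<open>A closed subset of the compact space \<open>AO_N t \<Phi>\<close> is compact
    there, hence also in the full space of orderings.\<close>
  have "compactin ?X T \<and> T \<subseteq> AO_N t \<Phi>" if "closedin (subtopology ?X (AO_N t \<Phi>)) T" for T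
  proof -
    have "T \<subseteq> AO_N t \<Phi>" using closedin_subset[OF that] by simp
    moreover have "compactin (subtopology ?X (AO_N t \<Phi>)) (AO_N t \<Phi>)"
      using compactin_AO_N by simp
    ultimately show ?thesis
      using closed_compactin[OF _ _ that] compactin_subtopology by blast
  qed
  then show ?thesis
    using universal_groebner_basis_compact
      universal_groebner_basis_compact[OF compactin_AO_N order_refl]
      universal_groebner_basis_compact[OF compactin_DCO_N DCO_N_subset_AO_N]
    by simp
qed

end
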